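(* Let $|||\cdot|||$ be any unitarily invariant norm on the space of $n\times n$ complex matrices. Let $W$ be an $n\times n$ complex unitary matrix such that $-1$ is not an eigenvalue of $W'W$, with factorization $W=W_1W_2$, where $W_1$ is real orthogonal and $W_2$ is a symmetric unitary matrix with all eigenvalues in the open right half plane, and let $\sigma(W_2)=\{e^{i\theta_1},\ldots,e^{i\theta_n}\}$. Let $\{a_m\}_{m\in\mathbb Z}$ be any $\ell_1$-sequence such that $\sum_{m=-\infty}^{\infty}(-1)^m a_m e^{im\theta}=\frac{1}{1+e^{i\theta}}$ for all $\theta=\theta_i-\theta_j$ $(1\leq i,j\leq n)$. Then for $k=1,2$ $$|||\tilde W_k-W_k|||\lesssim 2\left(\sum_{m=-\infty}^{\infty}|a_m|\right)|||\tilde W-W|||,$$ where $\tilde W$ denotes a unitary perturbation of $W$ and $\tilde W=\tilde W_1\tilde W_2$ is the corresponding factorization.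
   Context: $W'$ denotes the transpose of $W$ and $\sigma$ the spectrum. Let $\mathbb U$ be the set of $n\times n$ complex unitary matrices $W$ with $-1\notin\sigma(W'W)$. Every $W\in\mathbb U$ factors uniquely as $W=W_1W_2$ with $W_1$ real orthogonal and $W_2$ unitary, symmetric ($W_2'=W_2$), with all eigenvalues in the open right half plane. Here $\tilde W\in\mathbb U$ is any matrix in a sufficiently small neighbourhood of $W$ in $\mathbb U$, and $\tilde W_1,\tilde W_2$ are its factors in this factorization. The notation $|||f(\tilde W)-f(W)|||\lesssim c\,|||\tilde W-W|||$ means the first-order bound $|||f(\tilde W)-f(W)|||\leq c\,|||\tilde W-W|||+O(|||\tilde W-W|||^2)$ as $\tilde W\to W$. A norm is unitarily invariant if $|||UAV|||=|||A|||$ for all matrices $A$ and all unitary $U,V$. *)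

theory Defs
  imports "HOL-Analysis.Analysis" "HOL-Library.Landau_Symbols"
begin

definition adjoint_matrix :: "complex^'n^'n \<Rightarrow> complex^'n^'n" where
  "adjoint_matrix A = transpose (map_matrix cnj A)"

definition unitary_matrix :: "complex^'n^'n \<Rightarrow> bool" where
  "unitary_matrix U \<longleftrightarrow>
     adjoint_matrix U ** U = mat 1 \<and> U ** adjoint_matrix U = mat 1"

definition real_orthogonal_matrix :: "complex^'n^'n \<Rightarrow> bool" where
  "real_orthogonal_matrix A \<longleftrightarrow>
     (\<exists>Q :: real^'n^'n. orthogonal_matrix Q \<and> A = map_matrix complex_of_real Q)"

definition spectrum :: "complex^'n^'n \<Rightarrow> complex set" where
  "spectrum A = {z. \<exists>v. v \<noteq> 0 \<and> A *v v = z *s v}"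

text \<open>The transpose in the condition on the spectrum is the plain one, without conjugation.\<close>

definition admissible_unitaries :: "(complex^'n^'n) set" where
  "admissible_unitaries = {W. unitary_matrix W \<and> -1 \<notin> spectrum (transpose W ** W)}"

definition is_factorization ::
    "complex^'n^'n \<Rightarrow> complex^'n^'n \<Rightarrow> complex^'n^'n \<Rightarrow> bool" where
  "is_factorization W W1 W2 \<longleftrightarrow>
     W = W1 ** W2 \<and> real_orthogonal_matrix W1 \<and>
     unitary_matrix W2 \<and> transpose W2 = W2 \<and> (\<forall>z \<in> spectrum W2. Re z > 0)"

text \<open>The two factors as functions of \<open>W\<close>. The factorization exists and is unique for
  \<open>W \<in> admissible_unitaries\<close>; elsewhere the values are irrelevant.\<close>

definition orthogonal_factor :: "complex^'n^'n \<Rightarrow> complex^'n^'n" where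
  "orthogonal_factor W = (THE W1. \<exists>W2. is_factorization W W1 W2)"

definition symmetric_factor :: "complex^'n^'n \<Rightarrow> complex^'n^'n" where
  "symmetric_factor W = (THE W2. \<exists>W1. is_factorization W W1 W2)"

definition matrix_norm :: "(complex^'n^'n \<Rightarrow> real) \<Rightarrow> bool" where
  "matrix_norm N \<longleftrightarrow>
     (\<forall>A. 0 \<le> N A) \<and> (\<forall>A. N A = 0 \<longleftrightarrow> A = 0) \<and>
     (\<forall>c A. N (map_matrix ((*) c) A) = cmod c * N A) \<and>
     (\<forall>A B. N (A + B) \<le> N A + N B)"

definition unitarily_invariant_norm :: "(complex^'n^'n \<Rightarrow> real) \<Rightarrow> bool" where
  "unitarily_invariant_norm N \<longleftrightarrow>
     matrix_norm N \<and>
     (\<forall>U A V. unitary_matrix U \<and> unitary_matrix V \<longrightarrow> N (U ** A ** V) = N A)"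

text \<open>\<open>N (f V - f W) \<le> c * N (V - W) + O((N (V - W))\<^sup>2)\<close> as \<open>V \<rightarrow> W\<close> within \<open>S\<close>.
  The filter is that of the Euclidean topology, which every norm \<open>N\<close> on this
  finite-dimensional space induces.\<close>

definition first_order_bound ::
    "(complex^'n^'n \<Rightarrow> real) \<Rightarrow> (complex^'n^'n) set \<Rightarrow> complex^'n^'n \<Rightarrow>
     (complex^'n^'n \<Rightarrow> complex^'n^'n) \<Rightarrow> real \<Rightarrow> bool" where
  "first_order_bound N S W f c \<longleftrightarrow>
     (\<exists>r :: complex^'n^'n \<Rightarrow> real. r \<in> O[at W within S](\<lambda>V. (N (V - W))\<^sup>2) \<and>
        (\<forall>\<^sub>F V in at W within S. N (f V - f W) \<le> c * N (V - W) + r V))"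

end

theory Submission
  imports Defs "HOL-Computational_Algebra.Fundamental_Theorem_Algebra"
begin

text \<open>Replacing \<open>W\<close> and its perturbation \<open>V\<close> by their products with the inverse of \<open>W1\<close>, one
  compares \<open>P = W2\<close> with \<open>Q S\<close>, where \<open>Q\<close> is real orthogonal and \<open>S\<close> is the symmetric factor of
  \<open>V\<close>. To first order, both \<open>Q - 1\<close> and \<open>S - P\<close> solve a Sylvester equation \<open>P A + A P = G\<close> in which
  \<open>G\<close> has norm at most twice that of the perturbation. In an eigenbasis of \<open>P\<close> the solution has
  entries \<open>G i j / (l i + l j)\<close>, and the hypothesis on \<open>a\<close> turns this into the series
  \<open>A = (\<Sum>m. (-1)^m a m P^(-1-m) G P^m)\<close>, each term of which has the norm \<open>cmod (a m)\<close> times that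
  of \<open>G\<close>. The remainders are quadratic because \<open>S\<close> depends on \<open>V\<close> in a Lipschitz way: in
  \<open>S (S - P) + (S - P) P = S S - P P\<close> the denominators are bounded away from 0.\<close>

section \<open>Unitary diagonalization\<close>

text \<open>The vector \<open>p(A) v\<close> in Horner form; with \<open>v\<close> kept fixed, only
  the action of \<open>A\<close> on vectors enters, never a power of a matrix.\<close>

definition poly_act :: "complex^'n^'n \<Rightarrow> complex poly \<Rightarrow> complex^'n \<Rightarrow> complex^'n" where
  "poly_act A p v = fold_coeffs (\<lambda>c w. c *s v + A *v w) p 0"

lemma poly_act_0 [simp]: "poly_act A 0 v = 0"
  by (simp add: poly_act_def)

lemma poly_act_pCons [simp]: "poly_act A (pCons c p) v = c *s v + A *v poly_act A p v"
proof (cases "p = 0 \<and> c = 0")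
  case False
  then show ?thesis
    by (cases "p = 0") (auto simp: poly_act_def fold_coeffs_pCons_coeff_not_0_eq fold_coeffs_pCons_not_0_0_eq)
qed (auto simp: poly_act_def)

lemma poly_act_add: "poly_act A (p + q) v = poly_act A p v + poly_act A q v"
  by (induction p q rule: poly_induct2)
     (simp_all add: matrix_vector_right_distrib vector_sadd_rdistrib)

lemma poly_act_diff: "poly_act A (p - q) v = poly_act A p v - poly_act A q v"
  by (metis add_diff_cancel_right' diff_add_cancel poly_act_add)

lemma poly_act_smult: "poly_act A (smult c p) v = c *s poly_act A p v"
  by (induction p) (simp_all add: vector_scalar_commute vector_add_ldistrib)

lemma poly_act_monom: "poly_act A (monom c k) v = c *s (((*v) A) ^^ k) v"
  by (induction k) (simp_all add: monom_0 monom_Suc vector_scalar_commute)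

lemma poly_act_sum: "finite S \<Longrightarrow> poly_act A (\<Sum>x\<in>S. f x) v = (\<Sum>x\<in>S. poly_act A (f x) v)"
  by (induction S rule: finite_induct) (simp_all add: poly_act_add)

lemma poly_act_closed:
  assumes "0 \<in> V" "\<And>x y. x \<in> V \<Longrightarrow> y \<in> V \<Longrightarrow> x + y \<in> V"
    and "\<And>c x. x \<in> V \<Longrightarrow> c *s x \<in> V" "\<And>x. x \<in> V \<Longrightarrow> A *v x \<in> V" "v \<in> V"
  shows "poly_act A p v \<in> V"
  by (induction p) (use assms in simp_all)

text \<open>The iterates of \<open>v\<close> under \<open>A\<close> up to the exponent
  \<open>DIM(complex^'n)\<close>, the real dimension, are one too many to be independent. A real
  linear relation suffices, since only existence matters and not the degree.\<close>

lemma exists_annihilating_poly: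
  fixes A :: "complex^'n^'n"
  shows "\<exists>p. p \<noteq> 0 \<and> poly_act A p v = 0"
proof -
  define f where "f k = (((*v) A) ^^ k) v" for k
  define S where "S = {..DIM(complex^'n)}"
  show ?thesis
  \<comment> \<open>The dimension count concerns a set of vectors, so repeated iterates are treated
    separately; they give the polynomial \<open>x^i - x^j\<close> at once.\<close>
  proof (cases "inj_on f S")
    case True
    then have "dependent (f ` S)"
      by (intro dependent_biggerset) (simp add: card_image S_def)
    then obtain t u where t: "finite t" "t \<subseteq> f ` S" "(\<Sum>x\<in>t. u x *\<^sub>R x) = 0" "\<exists>x\<in>t. u x \<noteq> 0"
      unfolding dependent_explicit by blast
    then obtain T where T: "T \<subseteq> S" "t = f ` T"
      by (meson subset_imageE)
    have inj: "inj_on f T"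
      using T True inj_on_subset by blast
    have fT: "finite T"
      using T by (auto simp: S_def intro: finite_subset)
    define p where "p = (\<Sum>k\<in>T. monom (of_real (u (f k))) k :: complex poly)"
    have "poly_act A p v = (\<Sum>k\<in>T. u (f k) *\<^sub>R f k)"
      unfolding p_def poly_act_sum[OF fT] poly_act_monom f_def
      by (intro sum.cong) (simp_all add: vec_eq_iff scaleR_conv_of_real[where 'a=complex])
    also have "\<dots> = 0"
      using t(3) inj by (simp add: T(2) sum.reindex)
    finally have "poly_act A p v = 0" .
    moreover obtain k where k: "k \<in> T" "u (f k) \<noteq> 0"
      using t(4) T(2) by auto
    then have "coeff p k = of_real (u (f k))"
      unfolding p_def coeff_sum using fT by simp
    then have "p \<noteq> 0"
      using k by auto
    ultimately show ?thesis by blast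
  next
    case False
    then obtain i j where ij: "i \<noteq> j" "f i = f j"
      by (auto simp: inj_on_def)
    define p where "p = monom 1 i + monom (-1 :: complex) j"
    have "poly_act A p v = 0"
      using ij by (simp add: p_def poly_act_add poly_act_monom f_def)
    moreover have "coeff p i = 1"
      using ij by (simp add: p_def)
    then have "p \<noteq> 0" by auto
    ultimately show ?thesis by blast
  qed
qed

text \<open>Take an annihilating polynomial \<open>p\<close> of \<open>v\<close> of least degree and
  split off a root, \<open>p = (x - z) q\<close>. By minimality \<open>q(A) v\<close> is nonzero,
  and \<open>A - z\<close> kills it. As a polynomial in \<open>A\<close> applied to
  \<open>v\<close>, it stays in \<open>V\<close>.\<close>

lemma eigenvector_in_invariant_subspace:
  fixes A :: "complex^'n^'n"
  assumes V: "0 \<in> V" "\<And>x y. x \<in> V \<Longrightarrow> y \<in> V \<Longrightarrow> x + y \<in> V"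
    "\<And>c x. x \<in> V \<Longrightarrow> c *s x \<in> V" "\<And>x. x \<in> V \<Longrightarrow> A *v x \<in> V"
    and v: "v \<in> V" "v \<noteq> 0"
  obtains w z where "w \<in> V" "w \<noteq> 0" "A *v w = z *s w"
proof -
  obtain p where p: "p \<noteq> 0" "poly_act A p v = 0"
    and min: "\<And>q. q \<noteq> 0 \<Longrightarrow> poly_act A q v = 0 \<Longrightarrow> degree p \<le> degree q"
    using exists_annihilating_poly[of A v]
      ex_has_least_nat[of "\<lambda>p. p \<noteq> 0 \<and> poly_act A p v = 0" _ degree] by blast
  have "degree p \<noteq> 0"
  proof
    assume "degree p = 0"
    then obtain c where "p = [:c:]" by (metis degree_eq_zeroE)
    then show False using p v by simp
  qed
  then obtain z where "poly p z = 0"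
    by (metis constant_degree fundamental_theorem_of_algebra)
  then obtain q where q: "p = [:-z, 1:] * q"
    by (metis dvdE poly_eq_0_iff_dvd)
  have q0: "q \<noteq> 0" using q p by auto
  have "degree p = Suc (degree q)"
    unfolding q using q0 by (subst degree_mult_eq) auto
  then have "poly_act A q v \<noteq> 0"
    using min[of q] q0 by auto
  moreover have "A *v poly_act A q v = z *s poly_act A q v"
    using p(2) unfolding q
    by (simp add: poly_act_diff poly_act_smult)
  moreover have "poly_act A q v \<in> V"
    by (rule poly_act_closed) (use V v in auto)
  ultimately show ?thesis using that by blast
qed

section \<open>The Hermitian inner product, conjugate-linear in the first argument, and orthonormal
  eigenvectors\<close>

definition cinner :: "complex^'n \<Rightarrow> complex^'n \<Rightarrow> complex" where
  "cinner x y = (\<Sum>i\<in>UNIV. cnj (x $ i) * y $ i)"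

lemma cinner_0_right [simp]: "cinner x 0 = 0"
  by (simp add: cinner_def)

lemma cinner_add_right: "cinner x (y + z) = cinner x y + cinner x z"
  by (simp add: cinner_def distrib_left sum.distrib)

lemma cinner_scale_right: "cinner x (c *s y) = c * cinner x y"
  by (simp add: cinner_def sum_distrib_left mult_ac)

lemma cinner_scale_left: "cinner (c *s x) y = cnj c * cinner x y"
  by (simp add: cinner_def sum_distrib_left mult_ac)

lemma cinner_commute: "cinner y x = cnj (cinner x y)"
  by (simp add: cinner_def mult.commute)

lemma cinner_self: "cinner x x = of_real ((norm x)\<^sup>2)"
proof -
  have "cinner x x = (\<Sum>i\<in>UNIV. of_real ((cmod (x $ i))\<^sup>2))"
    unfolding cinner_def by (intro sum.cong refl) (metis complex_norm_square mult.commute)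
  then show ?thesis
    by (simp add: norm_vec_def L2_set_def sum_nonneg)
qed

lemma cinner_adjoint: "cinner x (A *v y) = cinner (adjoint_matrix A *v x) y"
proof -
  have "cinner x (A *v y) = (\<Sum>i\<in>UNIV. \<Sum>j\<in>UNIV. cnj (x $ i) * (A $ i $ j * y $ j))"
    by (simp add: cinner_def matrix_vector_mult_def sum_distrib_left)
  also have "\<dots> = (\<Sum>j\<in>UNIV. \<Sum>i\<in>UNIV. cnj (x $ i) * (A $ i $ j * y $ j))"
    by (rule sum.swap)
  also have "\<dots> = cinner (adjoint_matrix A *v x) y"
    by (simp add: cinner_def matrix_vector_mult_def adjoint_matrix_def transpose_def
        sum_distrib_left sum_distrib_right mult_ac)
  finally show ?thesis .
qed

lemma cinner_unitary:
  "unitary_matrix U \<Longrightarrow> cinner (U *v x) (U *v y) = cinner x y"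
  by (simp add: cinner_adjoint matrix_vector_mul_assoc unitary_matrix_def)

text \<open>A dimension count by determinants: the conjugated \<open>f i\<close> are the rows of a
  matrix whose row \<open>k\<close> is zero, so that it is singular and has a nontrivial
  kernel.\<close>

lemma exists_orthogonal_vector:
  fixes f :: "'n \<Rightarrow> complex^'n"
  assumes "k \<notin> I"
  shows "\<exists>v. v \<noteq> 0 \<and> (\<forall>i\<in>I. cinner (f i) v = 0)"
proof -
  define A :: "complex^'n^'n" where "A = (\<chi> i j. if i \<in> I then cnj (f i $ j) else 0)"
  have "row k A = 0"
    using assms by (simp add: A_def row_def vec_eq_iff)
  then have "det A = 0"
    by (rule det_zero_row)
  then have "\<not> (\<exists>B. B ** A = mat 1)"
    by (metis invertible_det_nz invertible_left_inverse)
  then obtain v where v: "A *v v = 0" "v \<noteq> 0"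
    unfolding matrix_left_invertible_ker by blast
  have "cinner (f i) v = (A *v v) $ i" if "i \<in> I" for i
    using that by (simp add: cinner_def A_def matrix_vector_mult_def)
  with v show ?thesis by auto
qed

definition orthonormal_on :: "'i set \<Rightarrow> ('i \<Rightarrow> complex^'n) \<Rightarrow> bool" where
  "orthonormal_on I f \<longleftrightarrow> (\<forall>i\<in>I. \<forall>j\<in>I. cinner (f i) (f j) = of_bool (i = j))"

text \<open>Induction on the index set: the orthogonal complement of the eigenvectors found so far
  is nonzero and invariant under \<open>U\<close>, hence contains a further eigenvector. Indexing by
  subsets of \<open>'n\<close> makes \<open>I = UNIV\<close> yield a full basis.\<close>

lemma orthonormal_eigenvectors:
  fixes U :: "complex^'n^'n" and I :: "'n set"
  assumes U: "unitary_matrix U"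
  shows "\<exists>f d. orthonormal_on I f \<and> (\<forall>i\<in>I. U *v f i = d i *s f i)"
proof (induction I rule: finite_induct[OF finite])
  case 1
  then show ?case by (simp add: orthonormal_on_def)
next
  case (2 k I)
  then obtain f d where orth: "orthonormal_on I f" and eig: "\<And>i. i \<in> I \<Longrightarrow> U *v f i = d i *s f i"
    by blast
  define V where "V = {v. \<forall>i\<in>I. cinner (f i) v = 0}"
  obtain v where v: "v \<in> V" "v \<noteq> 0"
    using exists_orthogonal_vector[OF \<open>k \<notin> I\<close>, of f] by (auto simp: V_def)
  have inv: "U *v x \<in> V" if "x \<in> V" for x
    unfolding V_def
  proof (intro CollectI ballI)
    fix i assume i: "i \<in> I"
    \<comment> \<open>Unitarity gives \<open>cinner (U *v f i) (U *v x) = cinner (f i) x\<close>,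
      where \<open>U *v f i\<close> is a multiple of \<open>f i\<close>. The same identity with
      \<open>x = f i\<close> shows that \<open>d i\<close> is nonzero and can be cancelled.\<close>
    have "cnj (d i) * cinner (f i) (U *v x) = cinner (f i) x"
      using cinner_unitary[OF U, of "f i" x] eig[OF i] by (simp add: cinner_scale_left)
    also have "\<dots> = 0"
      using that i by (simp add: V_def)
    finally have *: "cnj (d i) * cinner (f i) (U *v x) = 0" .
    have "d i * cnj (d i) * cinner (f i) (f i) = cinner (f i) (f i)"
      using cinner_unitary[OF U, of "f i" "f i"] eig[OF i]
      by (simp add: cinner_scale_left cinner_scale_right)
    then have "d i \<noteq> 0"
      using orth i by (auto simp: orthonormal_on_def)
    with * show "cinner (f i) (U *v x) = 0" by simp
  qed
  obtain w z where w: "w \<in> V" "w \<noteq> 0" "U *v w = z *s w"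
    by (rule eigenvector_in_invariant_subspace[where V = V and A = U and v = v])
       (use v inv in \<open>auto simp: V_def cinner_add_right cinner_scale_right\<close>)
  define u where "u = of_real (inverse (norm w)) *s w"
  have "cinner u u = 1"
    unfolding u_def cinner_scale_left cinner_scale_right unfolding cinner_self
    using w by (simp add: power2_eq_square field_simps)
  moreover have "u \<in> V" "U *v u = z *s u"
    using w by (simp_all add: u_def V_def cinner_scale_right vector_scalar_commute
        vector_smult_assoc mult.commute)
  ultimately have u: "cinner u u = 1" "u \<in> V" "U *v u = z *s u" .
  have uf: "cinner (f i) u = 0" "cinner u (f i) = 0" if "i \<in> I" for i
    using u(2) that by (auto simp: V_def cinner_commute[of u "f i"])
  have "orthonormal_on (insert k I) (f(k := u))"
    using orth u(1) uf \<open>k \<notin> I\<close> by (auto simp: orthonormal_on_def)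
  moreover have "\<forall>i\<in>insert k I. U *v (f(k := u)) i = (d(k := z)) i *s (f(k := u)) i"
    using eig u(3) \<open>k \<notin> I\<close> by auto
  ultimately show ?case by blast
qed

section \<open>Diagonal, adjoint and unitary matrices, and the spectral theorem for
  unitaries\<close>

definition diag_matrix :: "('n \<Rightarrow> complex) \<Rightarrow> complex^'n^'n" where
  "diag_matrix d = (\<chi> i j. if i = j then d i else 0)"

lemma diag_matrix_mult_left: "(diag_matrix d ** A) $ i $ j = d i * A $ i $ j"
  by (simp add: diag_matrix_def matrix_matrix_mult_def if_distrib[of "\<lambda>x. x * _"] cong: if_cong)

lemma diag_matrix_mult_right: "(A ** diag_matrix d) $ i $ j = A $ i $ j * d j"
  by (simp add: diag_matrix_def matrix_matrix_mult_def if_distrib[of "\<lambda>x. _ * x"] cong: if_cong)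

lemma diag_matrix_vector: "(diag_matrix d *v v) $ i = d i * v $ i"
  by (simp add: diag_matrix_def matrix_vector_mult_def if_distrib[of "\<lambda>x. x * _"] cong: if_cong)

lemma diag_matrix_mult: "diag_matrix d ** diag_matrix e = diag_matrix (\<lambda>i. d i * e i)"
  by (simp add: vec_eq_iff diag_matrix_mult_left) (simp add: diag_matrix_def)

lemma diag_matrix_1: "diag_matrix (\<lambda>_. 1) = mat 1"
  by (simp add: diag_matrix_def mat_def)

lemma transpose_diag_matrix [simp]: "transpose (diag_matrix d) = diag_matrix d"
  by (simp add: diag_matrix_def transpose_def vec_eq_iff)

lemma adjoint_diag_matrix: "adjoint_matrix (diag_matrix d) = diag_matrix (\<lambda>i. cnj (d i))"
  by (simp add: adjoint_matrix_def diag_matrix_def transpose_def vec_eq_iff)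

lemma adjoint_matrix_mult: "adjoint_matrix (A ** B) = adjoint_matrix B ** adjoint_matrix A"
  by (simp add: adjoint_matrix_def transpose_def vec_eq_iff matrix_matrix_mult_def mult.commute)

lemma adjoint_adjoint_matrix [simp]: "adjoint_matrix (adjoint_matrix A) = A"
  by (simp add: adjoint_matrix_def transpose_def vec_eq_iff)

lemma transpose_adjoint_matrix:
  "transpose (adjoint_matrix A) = adjoint_matrix (transpose A)"
  by (simp add: adjoint_matrix_def transpose_def vec_eq_iff)

lemma adjoint_matrix_mat_1 [simp]: "adjoint_matrix (mat 1) = mat 1"
  by (simp add: adjoint_matrix_def transpose_def mat_def vec_eq_iff)

lemma unitary_matrix_left_iff: "unitary_matrix U \<longleftrightarrow> adjoint_matrix U ** U = mat 1"
  using matrix_left_right_inverse[of U "adjoint_matrix U"] by (auto simp: unitary_matrix_def)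

text \<open>The last two equations cancel neighbours in products bracketed to the right; with
  \<open>matrix_mul_assoc[symmetric]\<close> they simplify words in unitaries.\<close>

lemma unitary_matrixD:
  assumes "unitary_matrix U"
  shows "adjoint_matrix U ** U = mat 1" "U ** adjoint_matrix U = mat 1"
    "adjoint_matrix U ** (U ** A) = A" "U ** (adjoint_matrix U ** A) = A"
  using assms by (auto simp: unitary_matrix_def matrix_mul_assoc)

lemma unitary_matrix_adjoint: "unitary_matrix U \<Longrightarrow> unitary_matrix (adjoint_matrix U)"
  by (simp add: unitary_matrix_def)

lemma unitary_matrix_mult:
  "unitary_matrix U \<Longrightarrow> unitary_matrix V \<Longrightarrow> unitary_matrix (U ** V)"
  by (simp add: unitary_matrix_left_iff[of "U ** V"] adjoint_matrix_mult
      matrix_mul_assoc[symmetric] unitary_matrixD)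

lemma unitary_matrix_transpose: "unitary_matrix U \<Longrightarrow> unitary_matrix (transpose U)"
  unfolding unitary_matrix_def transpose_adjoint_matrix[symmetric] matrix_transpose_mul[symmetric]
  by simp

lemma unitary_matrix_mat_1: "unitary_matrix (mat 1)"
  by (simp add: unitary_matrix_def)

lemma unitary_matrix_diag:
  assumes "\<And>i. cmod (d i) = 1"
  shows "unitary_matrix (diag_matrix d)"
proof -
  have "cnj (d i) * d i = 1" for i
    using assms[of i] by (metis complex_norm_square mult.commute of_real_1 power_one)
  then show ?thesis
    by (simp add: unitary_matrix_left_iff adjoint_diag_matrix diag_matrix_mult diag_matrix_1)
qed

lemma spectrum_diagonalized:
  assumes Z: "unitary_matrix Z"
  shows "spectrum (Z ** diag_matrix d ** adjoint_matrix Z) = range d"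
proof -
  have "z \<in> spectrum (Z ** diag_matrix d ** adjoint_matrix Z) \<longleftrightarrow> z \<in> range d" for z
  proof
    assume "z \<in> spectrum (Z ** diag_matrix d ** adjoint_matrix Z)"
    then obtain v where v: "v \<noteq> 0" "(Z ** diag_matrix d ** adjoint_matrix Z) *v v = z *s v"
      by (auto simp: spectrum_def)
    define w where "w = adjoint_matrix Z *v v"
    have "v = Z *v w"
      using Z by (simp add: w_def matrix_vector_mul_assoc unitary_matrixD)
    with v have "w \<noteq> 0" by auto
    then obtain i where i: "w $ i \<noteq> 0" by (auto simp: vec_eq_iff)
    have "diag_matrix d *v w = adjoint_matrix Z *v ((Z ** diag_matrix d ** adjoint_matrix Z) *v v)"
      using Z by (simp add: w_def matrix_vector_mul_assoc matrix_mul_assoc unitary_matrixD)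
    also have "\<dots> = z *s w"
      unfolding v(2) by (simp add: w_def vector_scalar_commute)
    finally have "(diag_matrix d *v w) $ i = z * w $ i"
      by simp
    then show "z \<in> range d"
      using i by (auto simp: diag_matrix_vector)
  next
    assume "z \<in> range d"
    then obtain i where z: "z = d i" by blast
    define v where "v = Z *v axis i 1"
    have *: "adjoint_matrix Z *v v = axis i 1"
      using Z by (simp add: v_def matrix_vector_mul_assoc unitary_matrixD)
    then have "v \<noteq> 0" by (metis axis_eq_0_iff matrix_vector_mult_0_right one_neq_zero)
    moreover have "diag_matrix d *v axis i 1 = z *s axis i 1"
      by (simp add: vec_eq_iff diag_matrix_vector z axis_def)
    then have "(Z ** diag_matrix d ** adjoint_matrix Z) *v v = z *s v"
      by (simp add: matrix_vector_mul_assoc[symmetric] * vector_scalar_commute)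
         (simp add: v_def vector_scalar_commute)
    ultimately show "z \<in> spectrum (Z ** diag_matrix d ** adjoint_matrix Z)"
      by (auto simp: spectrum_def)
  qed
  then show ?thesis by blast
qed

text \<open>The columns of \<open>Z\<close> are orthonormal eigenvectors. The conclusion on
  \<open>range d\<close> carries hypotheses on the spectrum over to the diagonal entries.\<close>

lemma unitary_diagonalization:
  fixes U :: "complex^'n^'n"
  assumes U: "unitary_matrix U"
  obtains Z d where "unitary_matrix Z" "U = Z ** diag_matrix d ** adjoint_matrix Z"
    "\<And>i. cmod (d i) = 1" "range d = spectrum U"
proof -
  obtain f :: "'n \<Rightarrow> complex^'n" and d where orth: "orthonormal_on UNIV f" and eig: "\<And>i. U *v f i = d i *s f i"
    using orthonormal_eigenvectors[OF U, of UNIV] by auto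
  define Z :: "complex^'n^'n" where "Z = (\<chi> i j. f j $ i)"
  have "(adjoint_matrix Z ** Z) $ i $ j = (mat 1 :: complex^'n^'n) $ i $ j" for i j
    using orth
    by (simp add: Z_def adjoint_matrix_def transpose_def matrix_matrix_mult_def mat_def
        orthonormal_on_def cinner_def)
  then have Z: "unitary_matrix Z"
    by (simp add: unitary_matrix_left_iff vec_eq_iff)
  have "(U ** Z) $ i $ j = (Z ** diag_matrix d) $ i $ j" for i j
    using arg_cong[OF eig[of j], of "\<lambda>x. x $ i"]
    by (simp add: diag_matrix_mult_right)
       (simp add: Z_def matrix_matrix_mult_def matrix_vector_mult_def mult.commute)
  then have UZ: "U ** Z = Z ** diag_matrix d"
    by (simp add: vec_eq_iff)
  then have Ueq: "U = Z ** diag_matrix d ** adjoint_matrix Z"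
    using Z by (metis matrix_mul_assoc matrix_mul_rid unitary_matrixD(2))
  have ff: "cinner (f i) (f i) = 1" for i
    using orth by (simp add: orthonormal_on_def)
  have cd: "cmod (d i) = 1" for i
  proof -
    have "cnj (d i) * d i = 1"
      using cinner_unitary[OF U, of "f i" "f i"] ff[of i] eig[of i]
      by (simp add: cinner_scale_left cinner_scale_right mult.commute)
    then have "(cmod (d i))\<^sup>2 = 1"
      by (metis complex_norm_square mult.commute of_real_eq_1_iff of_real_power)
    then show ?thesis
      by (metis norm_ge_zero power2_eq_1_iff one_neq_neg_one zero_le_one neg_0_le_iff_le not_one_le_zero)
  qed
  have "range d = spectrum U"
    unfolding Ueq by (rule spectrum_diagonalized[OF Z, symmetric])
  with that Z Ueq cd show thesis by blast
qed

section \<open>The factorization\<close>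

lemma matrix_mult_add_right: "(A + B) ** C = A ** C + B ** C"
  for A B :: "complex^'n^'m"
  by (simp add: vec_eq_iff matrix_matrix_mult_def distrib_right sum.distrib)

lemma matrix_mult_diff_right: "(A - B) ** C = A ** C - B ** C"
  for A B :: "complex^'n^'m"
  by (simp add: vec_eq_iff matrix_matrix_mult_def left_diff_distrib sum_subtractf)

lemma matrix_mult_diff_left: "C ** (A - B) = C ** A - C ** B"
  for A B :: "complex^'n^'m"
  by (simp add: vec_eq_iff matrix_matrix_mult_def right_diff_distrib sum_subtractf)

text \<open>The map sending \<open>Y\<close> to \<open>S Y + Y P\<close> is diagonal in an
  eigenbasis of \<open>S\<close> on the left and one of \<open>P\<close> on the right. Uniqueness of
  square roots, the Lipschitz bound and the series bound all rest on this.\<close>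

lemma sylvester_entry:
  assumes Z: "unitary_matrix Z" and R: "unitary_matrix R"
    and S: "S = Z ** diag_matrix d ** adjoint_matrix Z"
    and P: "P = R ** diag_matrix l ** adjoint_matrix R"
  shows "(adjoint_matrix Z ** (S ** Y + Y ** P) ** R) $ i $ j
    = (d i + l j) * (adjoint_matrix Z ** Y ** R) $ i $ j"
proof -
  have "adjoint_matrix Z ** (S ** Y + Y ** P) ** R
     = diag_matrix d ** (adjoint_matrix Z ** Y ** R) + (adjoint_matrix Z ** Y ** R) ** diag_matrix l"
    using Z R unfolding S P
    by (simp add: matrix_add_ldistrib matrix_mult_add_right matrix_mul_assoc[symmetric] unitary_matrixD)
  then show ?thesis
    by (simp add: diag_matrix_mult_left diag_matrix_mult_right algebra_simps)
qed

lemma unitary_conj_eq_0: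
  assumes "unitary_matrix Z" "unitary_matrix R" "adjoint_matrix Z ** Y ** R = 0"
  shows "Y = 0"
proof -
  have "Y = Z ** (adjoint_matrix Z ** Y ** R) ** adjoint_matrix R"
    using assms(1,2) by (simp add: matrix_mul_assoc[symmetric] unitary_matrixD)
  then show ?thesis using assms(3) by simp
qed

text \<open>The difference solves the homogeneous Sylvester equation
  \<open>S (S - T) + (S - T) T = S S - T T = 0\<close>, whose multipliers \<open>d i + l j\<close>
  have positive real part.\<close>

lemma unitary_sqrt_unique:
  assumes S: "unitary_matrix S" "\<And>z. z \<in> spectrum S \<Longrightarrow> Re z > 0"
    and T: "unitary_matrix T" "\<And>z. z \<in> spectrum T \<Longrightarrow> Re z > 0"
    and eq: "S ** S = T ** T"
  shows "S = T"
proof -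
  obtain Z d where Z: "unitary_matrix Z" "S = Z ** diag_matrix d ** adjoint_matrix Z"
    "range d = spectrum S"
    using unitary_diagonalization[OF S(1)] by metis
  obtain R l where R: "unitary_matrix R" "T = R ** diag_matrix l ** adjoint_matrix R"
    "range l = spectrum T"
    using unitary_diagonalization[OF T(1)] by metis
  have "S ** (S - T) + (S - T) ** T = 0"
    by (simp add: matrix_mult_diff_left matrix_mult_diff_right eq)
  then have "(d i + l j) * (adjoint_matrix Z ** (S - T) ** R) $ i $ j = 0" for i j
    using sylvester_entry[OF Z(1) R(1) Z(2) R(2), of "S - T" i j] by simp
  moreover have "d i + l j \<noteq> 0" for i j
  proof -
    have "Re (d i) > 0" "Re (l j) > 0"
      using S(2)[of "d i"] T(2)[of "l j"] Z(3) R(3) by (metis rangeI)+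
    then have "Re (d i + l j) > 0" by simp
    then show ?thesis by (metis less_irrefl zero_complex.sel(1))
  qed
  ultimately have "adjoint_matrix Z ** (S - T) ** R = 0"
    by (simp add: vec_eq_iff)
  then have "S - T = 0"
    by (rule unitary_conj_eq_0[OF Z(1) R(1)])
  then show ?thesis by simp
qed

text \<open>Equality of transpose and adjoint says that conjugation fixes every entry. In this form
  all further algebra stays within complex matrices.\<close>

lemma real_orthogonal_iff:
  "real_orthogonal_matrix A \<longleftrightarrow> unitary_matrix A \<and> transpose A = adjoint_matrix A"
proof
  assume "real_orthogonal_matrix A"
  then obtain Q where Q: "orthogonal_matrix Q" "A = map_matrix complex_of_real Q"
    by (auto simp: real_orthogonal_matrix_def)
  have tA: "transpose A = adjoint_matrix A"
    by (simp add: Q(2) adjoint_matrix_def transpose_def vec_eq_iff)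
  have "transpose A ** A = map_matrix complex_of_real (transpose Q ** Q)"
    by (simp add: Q(2) vec_eq_iff matrix_matrix_mult_def transpose_def)
  also have "\<dots> = mat 1"
    using Q(1) by (simp add: orthogonal_matrix_def mat_def vec_eq_iff)
  finally show "unitary_matrix A \<and> transpose A = adjoint_matrix A"
    using tA by (simp add: unitary_matrix_left_iff)
next
  assume A: "unitary_matrix A \<and> transpose A = adjoint_matrix A"
  define Q where "Q = map_matrix Re A"
  have "cnj (A $ i $ j) = A $ i $ j" for i j
    using arg_cong[OF conjunct2[OF A], of "\<lambda>B. B $ j $ i"] by (simp add: adjoint_matrix_def transpose_def)
  then have "complex_of_real (Re (A $ i $ j)) = A $ i $ j" for i j
    by (metis Reals_cnj_iff of_real_Re)
  then have AQ: "A = map_matrix complex_of_real Q"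
    by (simp add: Q_def vec_eq_iff)
  have "map_matrix complex_of_real (transpose Q ** Q) = transpose A ** A"
    unfolding AQ by (simp add: vec_eq_iff matrix_matrix_mult_def transpose_def)
  also have "\<dots> = mat 1"
    using A by (simp add: unitary_matrixD)
  also have "\<dots> = map_matrix complex_of_real (mat 1)"
    by (simp add: mat_def vec_eq_iff)
  finally have "transpose Q ** Q = mat 1"
    by (simp add: vec_eq_iff)
  then show "real_orthogonal_matrix A"
    using AQ by (auto simp: real_orthogonal_matrix_def orthogonal_matrix)
qed

section \<open>Uniqueness and existence of the two factors\<close>

lemma is_factorizationD:
  assumes "is_factorization W A B"
  shows "W = A ** B" "unitary_matrix A" "transpose A = adjoint_matrix A"
    "unitary_matrix B" "transpose B = B" "\<And>z. z \<in> spectrum B \<Longrightarrow> Re z > 0"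
  using assms unfolding is_factorization_def real_orthogonal_iff by blast+

lemma factorization_square:
  assumes "is_factorization W A B"
  shows "B ** B = transpose W ** W"
  unfolding is_factorizationD(1)[OF assms] matrix_transpose_mul is_factorizationD(3,5)[OF assms]
  using is_factorizationD(2)[OF assms] by (simp add: matrix_mul_assoc[symmetric] unitary_matrixD)

text \<open>The symmetric factor is determined as a square root of \<open>transpose W ** W\<close>,
  and then the orthogonal one is \<open>W\<close> times its inverse.\<close>

lemma factorization_unique:
  assumes "is_factorization W A B" "is_factorization W A' B'"
  shows "A = A'" "B = B'"
proof -
  show B: "B = B'"
  proof (rule unitary_sqrt_unique)
    show "B ** B = B' ** B'"
      using factorization_square[OF assms(1)] factorization_square[OF assms(2)] by (rule trans[OF _ sym])
  qed (fact is_factorizationD[OF assms(1)] is_factorizationD[OF assms(2)])+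
  have *: "A = W ** adjoint_matrix B" if "is_factorization W A B" for A B
    unfolding is_factorizationD(1)[OF that]
    using is_factorizationD(4)[OF that] by (simp add: matrix_mul_assoc[symmetric] unitary_matrixD)
  show "A = A'"
    using *[OF assms(1)] *[OF assms(2)] B by simp
qed

lemma factors_eq:
  assumes "is_factorization W A B"
  shows "orthogonal_factor W = A" "symmetric_factor W = B"
proof -
  show "orthogonal_factor W = A"
    unfolding orthogonal_factor_def
  proof (rule the_equality)
    show "\<exists>B. is_factorization W A B" using assms by (rule exI)
  qed (metis assms factorization_unique(1))
  show "symmetric_factor W = B"
    unfolding symmetric_factor_def
  proof (rule the_equality)
    show "\<exists>A. is_factorization W A B" using assms by (rule exI)
  qed (metis assms factorization_unique(2))
qed

text \<open>The symmetric factor \<open>S\<close> is the principal square root of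
  \<open>transpose W ** W\<close>, formed on the eigenvalues. Its transpose is a square root of the
  same symmetric matrix with the same spectrum, so uniqueness makes \<open>S\<close>
  symmetric.\<close>

lemma factorization_exists:
  assumes "W \<in> admissible_unitaries"
  shows "\<exists>A B. is_factorization W A B"
proof -
  have W: "unitary_matrix W" and spec: "-1 \<notin> spectrum (transpose W ** W)"
    using assms by (auto simp: admissible_unitaries_def)
  define G where "G = transpose W ** W"
  have G: "unitary_matrix G"
    unfolding G_def using W by (intro unitary_matrix_mult unitary_matrix_transpose)
  obtain Z d where Z: "unitary_matrix Z" and Geq: "G = Z ** diag_matrix d ** adjoint_matrix Z"
    and d: "\<And>i. cmod (d i) = 1" and dG: "range d = spectrum G"
    using unitary_diagonalization[OF G] by metis
  define e where "e i = csqrt (d i)" for i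
  have ee: "e i * e i = d i" for i
    by (simp add: e_def power2_eq_square[symmetric])
  have e1: "cmod (e i) = 1" for i
    using d[of i] by (simp add: e_def norm_csqrt)
  \<comment> \<open>The principal root has nonnegative real part. If that part were 0, modulus 1
    would force \<open>e i * e i = -1\<close>, an eigenvalue excluded by admissibility.\<close>
  have Re_e: "Re (e i) > 0" for i
  proof (rule ccontr)
    assume "\<not> Re (e i) > 0"
    then have "Re (e i) = 0"
      using csqrt_principal[of "d i"] by (auto simp: e_def)
    moreover have "(Re (e i))\<^sup>2 + (Im (e i))\<^sup>2 = 1"
      using e1[of i] by (simp add: cmod_def)
    ultimately have "Re (e i * e i) = - 1" "Im (e i * e i) = 0"
      by (simp_all add: power2_eq_square)
    then have "e i * e i = -1"
      by (intro complex_eqI) simp_all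
    then show False
      using ee[of i] spec dG by (metis G_def rangeI)
  qed
  define S where "S = Z ** diag_matrix e ** adjoint_matrix Z"
  have S: "unitary_matrix S"
    unfolding S_def using Z e1 by (intro unitary_matrix_mult unitary_matrix_adjoint unitary_matrix_diag)
  have SS: "S ** S = G"
  proof -
    have "S ** S = Z ** (diag_matrix e ** diag_matrix e) ** adjoint_matrix Z"
      using Z by (simp add: S_def matrix_mul_assoc[symmetric] unitary_matrixD)
    then show ?thesis by (simp add: diag_matrix_mult ee Geq)
  qed
  have spS: "spectrum S = range e"
    unfolding S_def by (rule spectrum_diagonalized[OF Z])
  \<comment> \<open>The entrywise conjugate of \<open>Z\<close>: it diagonalizes
    \<open>transpose S\<close> with the same diagonal \<open>e\<close>.\<close>
  define Z' where "Z' = transpose (adjoint_matrix Z)"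
  have Z': "unitary_matrix Z'"
    unfolding Z'_def using Z by (intro unitary_matrix_transpose unitary_matrix_adjoint)
  have "transpose S = Z' ** diag_matrix e ** adjoint_matrix Z'"
    unfolding S_def Z'_def matrix_transpose_mul transpose_diag_matrix
      transpose_adjoint_matrix[of "adjoint_matrix Z", symmetric] adjoint_adjoint_matrix
    by (rule matrix_mul_assoc)
  then have spS': "spectrum (transpose S) = range e"
    by (simp only: spectrum_diagonalized[OF Z'])
  have "transpose S ** transpose S = transpose (S ** S)"
    by (simp only: matrix_transpose_mul)
  also have "\<dots> = S ** S"
    by (simp only: SS G_def matrix_transpose_mul transpose_transpose)
  finally have sq: "transpose S ** transpose S = S ** S" .
  have symS: "transpose S = S"
  proof (rule unitary_sqrt_unique[OF _ _ S _ sq])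
    show "unitary_matrix (transpose S)" using S by (rule unitary_matrix_transpose)
  qed (use spS spS' Re_e in auto)
  define A where "A = W ** adjoint_matrix S"
  have A: "unitary_matrix A"
    unfolding A_def using W S by (intro unitary_matrix_mult unitary_matrix_adjoint)
  have "transpose A ** A = adjoint_matrix S ** (S ** S) ** adjoint_matrix S"
    by (simp add: A_def SS G_def matrix_transpose_mul transpose_adjoint_matrix symS matrix_mul_assoc)
  also have "\<dots> = mat 1"
    using S by (simp add: matrix_mul_assoc[symmetric] unitary_matrixD)
  finally have "transpose A ** A = mat 1" .
  then have "transpose A ** A ** adjoint_matrix A = adjoint_matrix A"
    by simp
  then have "transpose A = adjoint_matrix A"
    using A by (simp add: matrix_mul_assoc[symmetric] unitary_matrixD)
  moreover have "W = A ** S"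
    using S by (simp add: A_def matrix_mul_assoc[symmetric] unitary_matrixD)
  ultimately have "is_factorization W A S"
    using A S symS spS Re_e by (auto simp: is_factorization_def real_orthogonal_iff)
  then show ?thesis by blast
qed

section \<open>Unitarily invariant norms and Sylvester equations\<close>

locale ui_norm =
  fixes N :: "complex^'n^'n \<Rightarrow> real"
  assumes ui: "unitarily_invariant_norm N"
begin

lemma N_nonneg [simp]: "0 \<le> N A"
  and N_eq_0: "N A = 0 \<longleftrightarrow> A = 0"
  and N_scale: "N (map_matrix ((*) c) A) = cmod c * N A"
  and N_add: "N (A + B) \<le> N A + N B"
  using ui unfolding unitarily_invariant_norm_def matrix_norm_def by blast+

lemma N_0 [simp]: "N 0 = 0"
  by (simp add: N_eq_0)

lemma N_minus [simp]: "N (- A) = N A"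
proof -
  have "map_matrix ((*) (-1)) A = - A"
    by (simp add: vec_eq_iff)
  then show ?thesis
    using N_scale[of "-1" A] by simp
qed

lemma N_diff: "N (A - B) \<le> N A + N B"
  using N_add[of A "- B"] by simp

lemma N_diff_commute: "N (A - B) = N (B - A)"
  using N_minus[of "A - B"] by simp

lemma N_scaleR: "N (r *\<^sub>R A) = \<bar>r\<bar> * N A"
proof -
  have "r *\<^sub>R A = map_matrix ((*) (of_real r)) A"
    by (simp add: vec_eq_iff scaleR_conv_of_real[where 'a = complex])
  then show ?thesis
    by (simp add: N_scale)
qed

lemma N_sum: "N (sum f S) \<le> (\<Sum>x\<in>S. N (f x))"
proof (induction S rule: infinite_finite_induct)
  case (insert x F)
  then show ?case using N_add[of "f x" "sum f F"] by simp
qed auto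

lemma N_conj: "unitary_matrix U \<Longrightarrow> unitary_matrix V \<Longrightarrow> N (U ** A ** V) = N A"
  using ui by (simp add: unitarily_invariant_norm_def)

lemma N_mult_left: "unitary_matrix U \<Longrightarrow> N (U ** A) = N A"
  using N_conj[OF _ unitary_matrix_mat_1, of U A] by simp

lemma N_mult_right: "unitary_matrix V \<Longrightarrow> N (A ** V) = N A"
  using N_conj[OF unitary_matrix_mat_1, of V A] by simp

text \<open>Expand \<open>A\<close> in matrix units, with coefficients bounded by
  \<open>norm A\<close>. The constant is \<open>c + 1\<close> so that it is visibly
  positive.\<close>

lemma N_le_norm: "\<exists>c>0. \<forall>A. N A \<le> c * norm A"
proof -
  define E :: "'n \<Rightarrow> 'n \<Rightarrow> complex^'n^'n"
    where "E i j = (\<chi> k l. if k = i \<and> l = j then 1 else 0)" for i j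
  define c where "c = (\<Sum>i\<in>UNIV. \<Sum>j\<in>UNIV. N (E i j))"
  have "N A \<le> (c + 1) * norm A" for A
  proof -
    have entry: "cmod (A $ i $ j) \<le> norm A" for i j
      using Finite_Cartesian_Product.norm_nth_le[of "A $ i" j] Finite_Cartesian_Product.norm_nth_le[of A i]
      by (rule order_trans)
    have eq: "A = (\<Sum>i\<in>UNIV. \<Sum>j\<in>UNIV. map_matrix ((*) (A $ i $ j)) (E i j))"
    proof -
      have "(\<Sum>i\<in>UNIV. \<Sum>j\<in>UNIV. A $ i $ j * (if k = i \<and> l = j then 1 else 0)) = A $ k $ l" for k l
      proof -
        have "(\<Sum>j\<in>UNIV. A $ i $ j * (if k = i \<and> l = j then 1 else 0)) = (if k = i then A $ i $ l else 0)" for i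
          by (cases "k = i") (simp_all add: if_distrib[of "\<lambda>x. _ * x"] cong: if_cong)
        then show ?thesis by simp
      qed
      then show ?thesis by (simp add: vec_eq_iff E_def)
    qed
    have "N A \<le> (\<Sum>i\<in>UNIV. N (\<Sum>j\<in>UNIV. map_matrix ((*) (A $ i $ j)) (E i j)))"
      by (rule ord_eq_le_trans[OF arg_cong[OF eq, of N] N_sum])
    also have "\<dots> \<le> (\<Sum>i\<in>UNIV. \<Sum>j\<in>UNIV. N (map_matrix ((*) (A $ i $ j)) (E i j)))"
      by (intro sum_mono N_sum)
    also have "\<dots> \<le> (\<Sum>i\<in>UNIV. \<Sum>j\<in>UNIV. norm A * N (E i j))"
      unfolding N_scale by (intro sum_mono mult_right_mono entry) simp
    also have "\<dots> = c * norm A"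
      by (simp add: c_def sum_distrib_left sum_distrib_right mult.commute)
    finally show ?thesis by (simp add: distrib_right add_increasing2)
  qed
  moreover have "c + 1 > 0"
    unfolding c_def by (intro add_nonneg_pos sum_nonneg) auto
  ultimately show ?thesis by blast
qed

lemma continuous_on_N: "continuous_on S N"
proof -
  obtain c where c: "c > 0" "\<And>A. N A \<le> c * norm A"
    using N_le_norm by blast
  have "dist (N A) (N B) \<le> c * dist A B" for A B
  proof -
    have "N A \<le> N B + N (A - B)" "N B \<le> N A + N (A - B)"
      using N_add[of B "A - B"] N_add[of A "B - A"] N_diff_commute[of A B] by simp_all
    then show ?thesis
      using c(2)[of "A - B"] by (simp add: dist_norm dist_real_def)
  qed
  then have "c-lipschitz_on S N"
    using c(1) by (auto intro!: lipschitz_onI)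
  then show ?thesis
    by (rule lipschitz_on_continuous_on)
qed

text \<open>By compactness \<open>N\<close> attains its minimum on the Euclidean unit sphere, where
  it is positive; the rest is scaling.\<close>

lemma norm_le_N: "\<exists>c>0. \<forall>A. norm A \<le> c * N A"
proof -
  have "(sphere 0 1 :: (complex^'n^'n) set) \<noteq> {}" by simp
  then obtain B :: "complex^'n^'n" where B: "B \<in> sphere 0 1" "\<And>A. A \<in> sphere 0 1 \<Longrightarrow> N B \<le> N A"
    using continuous_attains_inf[OF compact_sphere _ continuous_on_N] by metis
  have "N B \<noteq> 0"
    using B(1) by (auto simp: N_eq_0)
  then have pos: "N B > 0"
    using N_nonneg[of B] by linarith
  have "norm A \<le> (1 / N B) * N A" for A
  proof (cases "A = 0")
    case False
    then have "N B \<le> N ((1 / norm A) *\<^sub>R A)"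
      by (intro B(2)) simp
    then show ?thesis
      using False pos by (simp add: N_scaleR field_simps)
  qed simp
  then show ?thesis
    using pos by (intro exI[of _ "1 / N B"]) auto
qed

lemma bilinear_matrix_mult: "bilinear ((**) :: complex^'n^'n \<Rightarrow> complex^'n^'n \<Rightarrow> complex^'n^'n)"
  unfolding bilinear_def
  by (intro conjI allI linearI)
    (simp_all add: matrix_add_ldistrib matrix_mult_add_right matrix_scalar_ac scalar_matrix_assoc)

text \<open>A positive multiple of \<open>N\<close> is again unitarily invariant, so a constant is
  unavoidable. It will enter only the coefficient of the quadratic remainder.\<close>

lemma N_mult: "\<exists>C>0. \<forall>A B. N (A ** B) \<le> C * N A * N B"
proof -
  obtain c where c: "c > 0" "\<And>A. N A \<le> c * norm A"
    using N_le_norm by blast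
  obtain d where d: "d > 0" "\<And>A. norm A \<le> d * N A"
    using norm_le_N by blast
  obtain b where b: "b > 0" "\<And>(A :: complex^'n^'n) (B :: complex^'n^'n). norm (A ** B) \<le> b * norm A * norm B"
    using bilinear_bounded_pos[OF bilinear_matrix_mult] by blast
  have "N (A ** B) \<le> (c * b * d * d) * N A * N B" for A B
  proof -
    have "N (A ** B) \<le> c * norm (A ** B)" by (rule c(2))
    also have "\<dots> \<le> c * (b * norm A * norm B)"
      by (rule mult_left_mono[OF b(2) less_imp_le[OF c(1)]])
    also have "b * norm A * norm B \<le> b * (d * N A) * (d * N B)"
      using less_imp_le[OF b(1)] less_imp_le[OF d(1)]
      by (intro mult_mono mult_left_mono d(2) mult_nonneg_nonneg N_nonneg norm_ge_zero)
    then have "c * (b * norm A * norm B) \<le> c * (b * (d * N A) * (d * N B))"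
      by (rule mult_left_mono[OF _ less_imp_le[OF c(1)]])
    finally show ?thesis by (simp add: mult_ac)
  qed
  moreover have "c * b * d * d > 0" by (simp only: mult_pos_pos b(1) c(1) d(1))
  ultimately show ?thesis by blast
qed

text \<open>Holds for arbitrary matrices by the singular value decomposition. A difference of
  unitaries becomes normal after multiplication with a unitary, which reduces the claim to
  diagonal matrices.\<close>

lemma N_transpose_diff_unitary:
  assumes U: "unitary_matrix U" and P: "unitary_matrix P"
  shows "N (transpose (U - P)) = N (U - P)"
proof -
  have PU: "unitary_matrix (adjoint_matrix P ** U)"
    using U P by (intro unitary_matrix_mult unitary_matrix_adjoint)
  obtain Z d where Z: "unitary_matrix Z" and d: "adjoint_matrix P ** U = Z ** diag_matrix d ** adjoint_matrix Z"
    by (rule unitary_diagonalization[OF PU]) (rule that)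
  define D where "D = diag_matrix (\<lambda>i. d i - 1)"
  have D: "D = diag_matrix d - mat 1"
    by (simp add: D_def diag_matrix_def mat_def vec_eq_iff)
  have eq: "U - P = (P ** Z) ** D ** adjoint_matrix Z"
  proof -
    have "U - P = P ** (adjoint_matrix P ** U - Z ** adjoint_matrix Z)"
      using P Z by (simp add: matrix_mult_diff_left matrix_mul_assoc[symmetric] unitary_matrixD)
    also have "\<dots> = (P ** Z) ** D ** adjoint_matrix Z"
      by (simp add: d D matrix_mult_diff_left matrix_mult_diff_right matrix_mul_assoc)
    finally show ?thesis .
  qed
  have "N (U - P) = N D"
    unfolding eq using P Z by (intro N_conj unitary_matrix_mult unitary_matrix_adjoint)
  moreover have "transpose (U - P) = transpose (adjoint_matrix Z) ** D ** transpose (P ** Z)"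
    unfolding eq by (simp only: matrix_transpose_mul D_def transpose_diag_matrix matrix_mul_assoc)
  then have "N (transpose (U - P)) = N D"
    using P Z by (simp only: N_conj unitary_matrix_mult unitary_matrix_adjoint unitary_matrix_transpose)
  ultimately show ?thesis by simp
qed

text \<open>In eigenbases each entry is divided by \<open>d i + l j\<close>, of modulus at least
  \<delta>, which controls the Euclidean norm; equivalence of norms carries this over to
  \<open>N\<close>. As real parts add, the gap \<delta> on the side of \<open>P\<close> makes
  \<open>K\<close> uniform in \<open>S\<close>. The constant is crude, but affects only quadratic
  terms.\<close>

lemma sylvester_lipschitz:
  assumes "\<delta> > 0"
  shows "\<exists>K>0. \<forall>S P Y. unitary_matrix S \<and> unitary_matrix P \<and> (\<forall>z\<in>spectrum S. Re z > 0)
      \<and> (\<forall>z\<in>spectrum P. Re z \<ge> \<delta>) \<longrightarrow> N Y \<le> K * N (S ** Y + Y ** P)"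
proof -
  obtain c where c: "c > 0" "\<And>A. N A \<le> c * norm A"
    using N_le_norm by blast
  obtain b where b: "b > 0" "\<And>A. norm A \<le> b * N A"
    using norm_le_N by blast
  have "N Y \<le> (c * b / \<delta>) * N (S ** Y + Y ** P)"
    if S: "unitary_matrix S" "\<forall>z\<in>spectrum S. Re z > 0"
      and P: "unitary_matrix P" "\<forall>z\<in>spectrum P. Re z \<ge> \<delta>" for S P Y
  proof -
    obtain Z d where Z: "unitary_matrix Z" "S = Z ** diag_matrix d ** adjoint_matrix Z"
      "range d = spectrum S"
      using unitary_diagonalization[OF S(1)] by metis
    obtain R l where R: "unitary_matrix R" "P = R ** diag_matrix l ** adjoint_matrix R"
      "range l = spectrum P"
      using unitary_diagonalization[OF P(1)] by metis
    define Y' where "Y' = adjoint_matrix Z ** Y ** R"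
    define F' where "F' = adjoint_matrix Z ** (S ** Y + Y ** P) ** R"
    have NY: "N Y' = N Y" "N F' = N (S ** Y + Y ** P)"
      unfolding Y'_def F'_def using Z R by (auto intro!: N_conj unitary_matrix_adjoint)
    have "\<delta> * cmod (Y' $ i $ j) \<le> cmod (F' $ i $ j)" for i j
    proof -
      have "F' $ i $ j = (d i + l j) * Y' $ i $ j"
        unfolding F'_def Y'_def by (rule sylvester_entry[OF Z(1) R(1) Z(2) R(2)])
      moreover have "Re (d i) > 0" "Re (l j) \<ge> \<delta>"
        using S(2) P(2) Z(3) R(3) by (metis rangeI)+
      then have "\<delta> \<le> cmod (d i + l j)"
        using complex_Re_le_cmod[of "d i + l j"] by simp
      ultimately show ?thesis
        by (simp add: norm_mult mult_right_mono)
    qed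
    then have "norm ((\<delta> *\<^sub>R Y') $ i) \<le> norm (F' $ i)" for i
      using assms by (intro norm_le_componentwise_cart) simp
    then have "norm (\<delta> *\<^sub>R Y') \<le> norm F'"
      by (rule norm_le_componentwise_cart)
    then have "\<delta> * norm Y' \<le> norm F'"
      using assms by simp
    then have "norm Y' \<le> norm F' / \<delta>"
      using assms by (simp add: field_simps)
    also have "\<dots> \<le> b * N F' / \<delta>"
      using b assms by (intro divide_right_mono) auto
    finally have "c * norm Y' \<le> c * (b * N F' / \<delta>)"
      using c(1) by (intro mult_left_mono) auto
    with c(2)[of Y'] show ?thesis
      by (simp add: NY)
  qed
  moreover have "c * b / \<delta> > 0"
    by (simp only: divide_pos_pos mult_pos_pos b(1) c(1) assms)
  ultimately show ?thesis by blast
qed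

text \<open>For \<open>l i = cis (t i)\<close> one has
  \<open>1 / (l i + l j) = cis (- t i) / (1 + cis (t j - t i))\<close>, and the hypothesis expands
  the right side. Each term multiplies the transformed right-hand side \<open>G\<close> by unitary
  diagonal matrices from both sides, so \<open>N\<close> sees only
  \<open>cmod (a m)\<close>.\<close>

lemma sylvester_series_bound:
  fixes \<theta> :: "'i \<Rightarrow> real" and a :: "int \<Rightarrow> complex"
  assumes P: "unitary_matrix P" "spectrum P = range (\<lambda>i. cis (\<theta> i))"
    and Re: "\<And>z. z \<in> spectrum P \<Longrightarrow> Re z > 0"
    and a: "(\<lambda>m. cmod (a m)) summable_on UNIV"
    and sum: "\<And>i j. (\<Sum>\<^sub>\<infinity>m. (-1) powi m * a m * cis (of_int m * (\<theta> i - \<theta> j)))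
        = 1 / (1 + cis (\<theta> i - \<theta> j))"
  shows "N X \<le> (\<Sum>\<^sub>\<infinity>m. cmod (a m)) * N (P ** X + X ** P)"
proof -
  obtain R l where R: "unitary_matrix R" "P = R ** diag_matrix l ** adjoint_matrix R"
    "range l = spectrum P"
    using unitary_diagonalization[OF P(1)] by metis
  \<comment> \<open>The angles list the spectrum as a set, in no relation to the eigenbasis;
    \<open>k\<close> picks an angle for each basis vector.\<close>
  have "\<forall>i. \<exists>k. l i = cis (\<theta> k)"
    using R(3) P(2) by (metis (no_types, lifting) rangeE rangeI)
  then obtain k where k: "\<And>i. l i = cis (\<theta> (k i))" by metis
  define t where "t i = \<theta> (k i)" for i
  have l: "l i = cis (t i)" for i
    by (simp add: t_def k)
  define X' where "X' = adjoint_matrix R ** X ** R"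
  define G where "G = adjoint_matrix R ** (P ** X + X ** P) ** R"
  have NX: "N X' = N X" "N G = N (P ** X + X ** P)"
    unfolding X'_def G_def using R by (auto intro!: N_conj unitary_matrix_adjoint)
  \<comment> \<open>The shift \<open>m + 1\<close> comes from the factor \<open>l i\<close> taken
    out of \<open>l i + l j\<close>.\<close>
  define L :: "int \<Rightarrow> complex^'n^'n"
    where "L m = diag_matrix (\<lambda>i. cis (- of_int (m + 1) * t i))" for m
  define M :: "int \<Rightarrow> complex^'n^'n"
    where "M m = diag_matrix (\<lambda>j. cis (of_int m * t j))" for m
  define T where "T m = map_matrix ((*) ((-1) powi m * a m)) (L m ** G ** M m)" for m
  have abs1: "cmod ((-1) powi m * a m) = cmod (a m)" for m
    by (simp add: norm_mult norm_power_int)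
  have NT: "N (T m) = cmod (a m) * N G" for m
    unfolding T_def N_scale abs1 L_def M_def by (subst N_conj) (auto intro: unitary_matrix_diag)
  have "((\<lambda>m. T m $ i $ j) has_sum X' $ i $ j) UNIV" for i j
  proof -
    let ?c = "\<lambda>m. (-1) powi m * a m * cis (of_int m * (t j - t i))"
    have "(\<lambda>m. norm (?c m)) summable_on UNIV"
      using a by (simp add: norm_mult norm_power_int)
    then have "(?c has_sum (\<Sum>\<^sub>\<infinity>m. ?c m)) UNIV"
      by (rule has_sum_infsum[OF abs_summable_summable])
    then have "(?c has_sum 1 / (1 + cis (t j - t i))) UNIV"
      unfolding t_def by (simp only: sum)
    then have "((\<lambda>m. ?c m * (cis (- t i) * G $ i $ j)) has_sum
        1 / (1 + cis (t j - t i)) * (cis (- t i) * G $ i $ j)) UNIV"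
      by (rule has_sum_cmult_left)
    moreover have "?c m * (cis (- t i) * G $ i $ j) = T m $ i $ j" for m
    proof -
      have "cis (of_int m * (t j - t i)) * cis (- t i)
          = cis (- of_int (m + 1) * t i) * cis (of_int m * t j)"
        by (simp add: cis_mult algebra_simps)
      then show ?thesis
        by (simp add: T_def L_def M_def diag_matrix_mult_left diag_matrix_mult_right mult_ac)
    qed
    moreover have "1 / (1 + cis (t j - t i)) * (cis (- t i) * G $ i $ j) = X' $ i $ j"
    proof -
      have "Re (l i) > 0" "Re (l j) > 0"
        using Re R(3) by (metis rangeI)+
      then have "Re (l i + l j) > 0" by simp
      then have nz: "l i + l j \<noteq> 0" by (metis less_irrefl zero_complex.sel(1))
      have "l i * (1 + cis (t j - t i)) = l i + l j"
        by (simp add: l distrib_left cis_mult)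
      then have "1 / (1 + cis (t j - t i)) = l i / (l i + l j)"
        using nz by (metis (no_types) cis_neq_zero l mult.right_neutral nonzero_mult_divide_mult_cancel_left)
      moreover have "G $ i $ j = (l i + l j) * X' $ i $ j"
        unfolding G_def X'_def by (rule sylvester_entry[OF R(1) R(1) R(2) R(2)])
      moreover have "l i * cis (- t i) = 1"
        by (simp add: l cis_mult)
      moreover have "u / v * (w * (v * x)) = x" if "v \<noteq> 0" "u * w = 1" for u v w x :: complex
        using that by (simp add: mult.assoc[symmetric])
      ultimately show ?thesis using nz by simp
    qed
    ultimately show ?thesis by simp
  qed
  \<comment> \<open>Entrywise convergence is convergence of matrices, so by continuity of
    \<open>N\<close> the bound on finite partial sums passes to the limit.\<close>
  then have "((\<lambda>F. sum T F) \<longlongrightarrow> X') (finite_subsets_at_top UNIV)"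
    unfolding has_sum_def by (intro vec_tendstoI) simp
  then have lim: "((\<lambda>F. N (sum T F)) \<longlongrightarrow> N X') (finite_subsets_at_top UNIV)"
    by (rule continuous_on_tendsto_compose[OF continuous_on_N[of UNIV]]) auto
  have "N (sum T F) \<le> (\<Sum>\<^sub>\<infinity>m. cmod (a m)) * N G" if "finite F" for F
  proof -
    have "N (sum T F) \<le> (\<Sum>m\<in>F. cmod (a m)) * N G"
      using N_sum[of T F] by (simp add: NT sum_distrib_right)
    also have "\<dots> \<le> (\<Sum>\<^sub>\<infinity>m. cmod (a m)) * N G"
      by (intro mult_right_mono finite_sum_le_infsum a that) auto
    finally show ?thesis .
  qed
  then have "\<forall>\<^sub>F F in finite_subsets_at_top UNIV. N (sum T F) \<le> (\<Sum>\<^sub>\<infinity>m. cmod (a m)) * N G"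
    unfolding eventually_finite_subsets_at_top by blast
  then have "N X' \<le> (\<Sum>\<^sub>\<infinity>m. cmod (a m)) * N G"
    by (rule tendsto_upperbound[OF lim]) simp
  then show ?thesis
    by (simp add: NX)
qed

end

section \<open>First-order estimates\<close>

lemma transpose_matrix_diff: "transpose (A - B) = transpose A - transpose (B :: complex^'n^'m)"
  by (simp add: transpose_def vec_eq_iff)

context ui_norm
begin

text \<open>With \<open>E = Q S - P\<close>, its transpose \<open>E'\<close>, \<open>X = Q - 1\<close> and \<open>Y = S - P\<close> one has, up to
  terms of second order, \<open>P X + X P = E - E'\<close> and \<open>P Y + Y P = P E + E' P\<close>.\<close>

lemma first_order_estimate:
  fixes \<theta> :: "'i \<Rightarrow> real" and a :: "int \<Rightarrow> complex"
  assumes P: "unitary_matrix P" "transpose P = P" "spectrum P = range (\<lambda>i. cis (\<theta> i))"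
    and Re: "\<And>z. z \<in> spectrum P \<Longrightarrow> Re z > 0"
    and a: "(\<lambda>m. cmod (a m)) summable_on UNIV"
    and sum: "\<And>i j. (\<Sum>\<^sub>\<infinity>m. (-1) powi m * a m * cis (of_int m * (\<theta> i - \<theta> j)))
        = 1 / (1 + cis (\<theta> i - \<theta> j))"
  shows "\<exists>c. \<forall>Q S. unitary_matrix Q \<and> transpose Q = adjoint_matrix Q \<and> unitary_matrix S
      \<and> transpose S = S \<and> (\<forall>z\<in>spectrum S. Re z > 0) \<longrightarrow>
      N (Q - mat 1) \<le> 2 * (\<Sum>\<^sub>\<infinity>m. cmod (a m)) * N (Q ** S - P) + c * (N (Q ** S - P))\<^sup>2 \<and>
      N (S - P) \<le> 2 * (\<Sum>\<^sub>\<infinity>m. cmod (a m)) * N (Q ** S - P) + c * (N (Q ** S - P))\<^sup>2"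
proof -
  define s where "s = (\<Sum>\<^sub>\<infinity>m. cmod (a m))"
  have s0: "s \<ge> 0"
    unfolding s_def by (intro infsum_nonneg) simp
  obtain l :: "'n \<Rightarrow> complex" where "range l = spectrum P"
    by (rule unitary_diagonalization[OF P(1)]) (rule that)
  have fin: "finite (spectrum P)" "spectrum P \<noteq> {}"
    unfolding \<open>range l = spectrum P\<close>[symmetric] by auto
  \<comment> \<open>The spectrum of the fixed matrix \<open>P\<close> is finite, so its distance to
    the imaginary axis is positive, and \<open>K\<close> below does not depend on \<open>Q\<close>
    or \<open>S\<close>.\<close>
  define \<delta> where "\<delta> = Min (Re ` spectrum P)"
  have \<delta>: "\<delta> > 0" "\<forall>z\<in>spectrum P. Re z \<ge> \<delta>"
    unfolding \<delta>_def using fin Re by auto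
  obtain K where K: "K > 0" "\<And>S Y. unitary_matrix S \<Longrightarrow> (\<forall>z\<in>spectrum S. Re z > 0) \<Longrightarrow>
      N Y \<le> K * N (S ** Y + Y ** P)"
    using sylvester_lipschitz[OF \<delta>(1)] P(1) \<delta>(2) by blast
  obtain C where C: "C > 0" "\<And>A B. N (A ** B) \<le> C * N A * N B"
    using N_mult by blast
  \<comment> \<open>Each Sylvester right-hand side below has three second-order products, each of
    norm at most \<open>C\<close> times the square of \<open>(1 + 2 * K) * e\<close>; the series
    bound contributes the factor \<open>s\<close>.\<close>
  define c where "c = 3 * s * C * (1 + 2 * K)\<^sup>2"
  have "N (Q - mat 1) \<le> 2 * s * N (Q ** S - P) + c * (N (Q ** S - P))\<^sup>2 \<and>
      N (S - P) \<le> 2 * s * N (Q ** S - P) + c * (N (Q ** S - P))\<^sup>2"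
    if Q: "unitary_matrix Q" "transpose Q = adjoint_matrix Q"
      and S: "unitary_matrix S" "transpose S = S" "\<forall>z\<in>spectrum S. Re z > 0" for Q S
  proof -
    define E where "E = Q ** S - P"
    define E' where "E' = S ** adjoint_matrix Q - P"
    define X where "X = Q - mat 1"
    define X' where "X' = adjoint_matrix Q - mat 1"
    define Y where "Y = S - P"
    define e where "e = N E"
    define x where "x = (1 + 2 * K) * e"
    note expand = matrix_mult_diff_left matrix_mult_diff_right matrix_add_ldistrib
      matrix_mult_add_right matrix_mul_assoc[symmetric] unitary_matrixD[OF Q(1)]
      matrix_mul_lid matrix_mul_rid
    have E': "E' = transpose (Q ** S - P)"
      by (simp only: E'_def transpose_matrix_diff matrix_transpose_mul Q(2) S(2) P(2))
    have NE': "N E' = e"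
      unfolding E' e_def E_def using Q S P by (intro N_transpose_diff_unitary unitary_matrix_mult)
    \<comment> \<open>Thus \<open>X'\<close> has the same norm as \<open>X\<close>, not merely one
      of the same order.\<close>
    have X': "X' = - (adjoint_matrix Q ** X)"
      by (simp add: X'_def X_def expand)
    have NX': "N X' = N X"
      unfolding X' N_minus by (rule N_mult_left[OF unitary_matrix_adjoint[OF Q(1)]])
    \<comment> \<open>Both sides equal \<open>S S - P P\<close>, because \<open>S S\<close> is the
      product of \<open>E' + P\<close> and \<open>Q S = E + P\<close>. This exact identity gives the
      a priori bound on \<open>Y\<close>, and from it the one on \<open>X\<close>.\<close>
    have SY: "S ** Y + Y ** P = E' ** (Q ** S) + P ** E"
      by (simp add: Y_def E_def E'_def expand)
    have XS: "X ** S = E - Y"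
      by (simp add: X_def E_def Y_def expand)
    \<comment> \<open>Expanding gives \<open>E = Y + X P + X Y\<close> and
      \<open>E' = Y + P X' + Y X'\<close>. In the difference \<open>Y\<close> cancels, and
      \<open>X + X' = - X X'\<close>, which expresses unitarity of \<open>Q\<close>, eliminates
      \<open>X'\<close> from the linear part.\<close>
    have PX: "P ** X + X ** P = (E - E') - X ** Y + Y ** X' - P ** (X ** X')"
      by (simp only: X_def X'_def E_def E'_def Y_def expand) (simp add: algebra_simps)
    \<comment> \<open>In \<open>P E + E' P\<close> the linear terms in \<open>X\<close> and
      \<open>X'\<close> combine to \<open>P (X + X') P = - P X X' P\<close>, which is of second
      order.\<close>
    have PY: "P ** Y + Y ** P = (P ** E + E' ** P) + P ** (X ** X') ** P - P ** (X ** Y) - (Y ** X') ** P"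
      by (simp only: X_def X'_def E_def E'_def Y_def expand) (simp add: algebra_simps)
    have e0: "e \<ge> 0" by (simp add: e_def)
    have "N (S ** Y + Y ** P) \<le> 2 * e"
      unfolding SY using N_add[of "E' ** (Q ** S)" "P ** E"]
      by (simp add: N_mult_right[OF unitary_matrix_mult[OF Q(1) S(1)]] N_mult_left[OF P(1)] NE'
          flip: e_def)
    then have "K * N (S ** Y + Y ** P) \<le> K * (2 * e)"
      using K(1) by simp
    then have NY: "N Y \<le> 2 * K * e"
      using K(2)[OF S(1) S(3), of Y] by simp
    have "N X = N (E - Y)"
      unfolding XS[symmetric] by (rule N_mult_right[OF S(1), symmetric])
    then have NX: "N X \<le> x"
      using N_diff[of E Y] NY by (simp add: x_def distrib_right flip: e_def)
    have NYx: "N Y \<le> x"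
      using NY e0 by (simp add: x_def distrib_right)
    have prod: "N (A ** B) \<le> C * x\<^sup>2" if "N A \<le> x" "N B \<le> x" for A B
    proof -
      have "N A * N B \<le> x * x"
        using that by (intro mult_mono order_trans[OF N_nonneg that(1)]) simp_all
      then have "C * (N A * N B) \<le> C * x\<^sup>2"
        using C(1) by (simp add: power2_eq_square)
      then show ?thesis
        using C(2)[of A B] by (simp add: mult.assoc)
    qed
    have XX': "N (X ** X') \<le> C * x\<^sup>2" and XY: "N (X ** Y) \<le> C * x\<^sup>2" and YX': "N (Y ** X') \<le> C * x\<^sup>2"
      using NX NYx NX' by (simp_all add: prod)
    have "N (P ** X + X ** P) \<le> N E + N E' + N (X ** Y) + N (Y ** X') + N (P ** (X ** X'))"
      unfolding PX
      using N_diff[of "(E - E') - X ** Y + Y ** X'" "P ** (X ** X')"]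
        N_add[of "(E - E') - X ** Y" "Y ** X'"] N_diff[of "E - E'" "X ** Y"] N_diff[of E E']
      by linarith
    then have PXb: "N (P ** X + X ** P) \<le> 2 * e + 3 * (C * x\<^sup>2)"
      using XX' XY YX' NE' by (simp add: N_mult_left[OF P(1)] flip: e_def)
    have "N (P ** Y + Y ** P) \<le> N (P ** E) + N (E' ** P) + N (P ** (X ** X') ** P)
        + N (P ** (X ** Y)) + N ((Y ** X') ** P)"
      unfolding PY
      using N_diff[of "(P ** E + E' ** P) + P ** (X ** X') ** P - P ** (X ** Y)" "(Y ** X') ** P"]
        N_diff[of "(P ** E + E' ** P) + P ** (X ** X') ** P" "P ** (X ** Y)"]
        N_add[of "P ** E + E' ** P" "P ** (X ** X') ** P"] N_add[of "P ** E" "E' ** P"]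
      by linarith
    then have PYb: "N (P ** Y + Y ** P) \<le> 2 * e + 3 * (C * x\<^sup>2)"
      using XX' XY YX' NE' by (simp add: N_mult_left[OF P(1)] N_mult_right[OF P(1)] flip: e_def)
    have bound: "s * (2 * e + 3 * (C * x\<^sup>2)) = 2 * s * e + c * e\<^sup>2"
      by (simp add: c_def x_def power_mult_distrib distrib_left)
    have series: "N A \<le> s * N (P ** A + A ** P)" for A
      unfolding s_def by (rule sylvester_series_bound[OF P(1,3) Re a sum])
    have "N X \<le> 2 * s * e + c * e\<^sup>2" "N Y \<le> 2 * s * e + c * e\<^sup>2"
      unfolding bound[symmetric]
      using order_trans[OF series mult_left_mono[OF PXb s0]]
        order_trans[OF series mult_left_mono[OF PYb s0]] by blast+
    then show ?thesis
      by (simp add: X_def Y_def e_def E_def)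
  qed
  then show ?thesis
    unfolding s_def by blast
qed

end

text \<open>An explicit quadratic remainder, valid on all of \<open>S\<close>, serves as the
  function \<open>r\<close>.\<close>

lemma first_order_boundI:
  assumes "\<And>V. V \<in> S \<Longrightarrow> N (f V - f W) \<le> c * N (V - W) + b * (N (V - W))\<^sup>2"
  shows "first_order_bound N S W f c"
  unfolding first_order_bound_def
proof (intro exI conjI)
  show "(\<lambda>V. b * (N (V - W))\<^sup>2) \<in> O[at W within S](\<lambda>V. (N (V - W))\<^sup>2)"
    by simp
  show "\<forall>\<^sub>F V in at W within S. N (f V - f W) \<le> c * N (V - W) + b * (N (V - W))\<^sup>2"
    using assms by (simp add: eventually_at_filter)
qed

theorem proposition5p1:
  fixes N :: "complex^'n^'n \<Rightarrow> real"
    and W W1 W2 :: "complex^'n^'n"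
    and \<theta> :: "'n \<Rightarrow> real"
    and a :: "int \<Rightarrow> complex"
  assumes "unitarily_invariant_norm N"
    and "unitary_matrix W"
    and "-1 \<notin> spectrum (transpose W ** W)"
    and "is_factorization W W1 W2"
    and "spectrum W2 = range (\<lambda>i. cis (\<theta> i))"
    and "(\<lambda>m. cmod (a m)) summable_on UNIV"
    and "\<And>i j. (\<Sum>\<^sub>\<infinity>m. (-1) powi m * a m * cis (of_int m * (\<theta> i - \<theta> j)))
                  = 1 / (1 + cis (\<theta> i - \<theta> j))"
  shows "\<forall>f \<in> {orthogonal_factor, symmetric_factor}.
           first_order_bound N admissible_unitaries W f (2 * (\<Sum>\<^sub>\<infinity>m. cmod (a m)))"
proof -
  interpret ui_norm N
    using assms(1) by unfold_locales
  let ?s = "\<Sum>\<^sub>\<infinity>m. cmod (a m)"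
  note W = is_factorizationD[OF assms(4)]
  obtain c where c: "\<And>Q S. unitary_matrix Q \<Longrightarrow> transpose Q = adjoint_matrix Q \<Longrightarrow>
      unitary_matrix S \<Longrightarrow> transpose S = S \<Longrightarrow> (\<forall>z\<in>spectrum S. Re z > 0) \<Longrightarrow>
      N (Q - mat 1) \<le> 2 * ?s * N (Q ** S - W2) + c * (N (Q ** S - W2))\<^sup>2 \<and>
      N (S - W2) \<le> 2 * ?s * N (Q ** S - W2) + c * (N (Q ** S - W2))\<^sup>2"
    using first_order_estimate[OF W(4,5) assms(5) W(6) assms(6,7)] by blast
  have est: "N (orthogonal_factor V - orthogonal_factor W) \<le> 2 * ?s * N (V - W) + c * (N (V - W))\<^sup>2 \<and>
      N (symmetric_factor V - symmetric_factor W) \<le> 2 * ?s * N (V - W) + c * (N (V - W))\<^sup>2"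
    if adm: "V \<in> admissible_unitaries" for V
  proof -
    obtain V1 V2 where fac: "is_factorization V V1 V2"
      using factorization_exists[OF adm] by blast
    note V = is_factorizationD[OF fac]
    \<comment> \<open>Multiplication by the inverse of \<open>W1\<close> moves the orthogonal factor
      of \<open>W\<close> to the identity and keeps both symmetric factors. \<open>Q\<close> is
      again real orthogonal, and invariance of \<open>N\<close> preserves the norms of the
      differences.\<close>
    define Q where "Q = adjoint_matrix W1 ** V1"
    have Q: "unitary_matrix Q"
      unfolding Q_def by (intro unitary_matrix_mult unitary_matrix_adjoint W(2) V(2))
    have tQ: "transpose Q = adjoint_matrix Q"
      by (simp only: Q_def matrix_transpose_mul transpose_adjoint_matrix W(3) V(3)
          adjoint_matrix_mult adjoint_adjoint_matrix)
    have "V - W = W1 ** (Q ** V2 - W2)"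
      by (simp only: V(1) W(1) Q_def matrix_mult_diff_left matrix_mul_assoc[symmetric]
          unitary_matrixD[OF W(2)])
    then have NE: "N (V - W) = N (Q ** V2 - W2)"
      using N_mult_left[OF W(2)] by simp
    have "V1 - W1 = W1 ** (Q - mat 1)"
      by (simp only: Q_def matrix_mult_diff_left matrix_mul_assoc[symmetric]
          unitary_matrixD[OF W(2)] matrix_mul_rid)
    then have NX: "N (V1 - W1) = N (Q - mat 1)"
      using N_mult_left[OF W(2)] by simp
    show ?thesis
      unfolding factors_eq[OF fac] factors_eq[OF assms(4)] NX NE
      using V(6) by (intro c Q tQ V(4,5)) blast
  qed
  show ?thesis
    using est by (auto intro!: first_order_boundI)
qed

end
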